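(* If $f\colon C^\circ\to C^\circ$ is an order-preserving homogeneous mapping on the interior $C^\circ$ of a polyhedral cone $C$ with nonempty interior in a finite dimensional real vector space, then there does not exist a point $x\in C^\circ$ such that $\mathcal{O}(x;f)$ has an accumulation point in $\partial C$ and $\mathcal{O}(x;f)$ is unbounded in the norm topology.
   Context: A cone $C$ is a convex set with $C\cap(-C)=\{0\}$ and $\lambda C\subseteq C$ for all $\lambda\ge0$; $x\le_C y$ means $y-x\in C$. A polyhedral cone is a cone which is the intersection of finitely many closed half-spaces $\{x\colon\varphi_i(x)\ge0\}$ with $\varphi_i$ linear functionals. $f$ is order-preserving if $x\le_C y$ implies $f(x)\le_C f(y)$, and homogeneous if $f(\lambda x)=\lambda f(x)$ for all $\lambda>0$. $\mathcal{O}(x;f)=\{f^k(x)\colon k\ge0\}$; its accumulation points are the limits of subsequences $(f^{k_i}(x))_i$ with $k_i\to\infty$ in the norm topology. *)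

theory Defs
  imports "HOL-Analysis.Analysis"
begin

text \<open>The library predicate \<open>cone\<close> only expresses closure under scaling by
  nonnegative reals; convexity and pointedness are part of the notion here.\<close>

definition pointed_cone :: "'a::real_vector set \<Rightarrow> bool" where
  "pointed_cone C \<longleftrightarrow> convex C \<and> C \<inter> uminus ` C = {0} \<and> cone C"

definition polyhedral_cone :: "'a::real_vector set \<Rightarrow> bool" where
  "polyhedral_cone C \<longleftrightarrow> pointed_cone C \<and>
     (\<exists>\<Phi> :: ('a \<Rightarrow> real) set. finite \<Phi> \<and> (\<forall>\<phi>\<in>\<Phi>. linear \<phi>) \<and> C = (\<Inter>\<phi>\<in>\<Phi>. {x. \<phi> x \<ge> 0}))"

definition cone_le :: "'a::real_vector set \<Rightarrow> 'a \<Rightarrow> 'a \<Rightarrow> bool" where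
  "cone_le C x y \<longleftrightarrow> y - x \<in> C"

definition order_preserving_on :: "'a::real_vector set \<Rightarrow> 'a set \<Rightarrow> ('a \<Rightarrow> 'a) \<Rightarrow> bool" where
  "order_preserving_on C D f \<longleftrightarrow>
     (\<forall>x\<in>D. \<forall>y\<in>D. cone_le C x y \<longrightarrow> cone_le C (f x) (f y))"

definition homogeneous_on :: "'a::real_vector set \<Rightarrow> ('a \<Rightarrow> 'a) \<Rightarrow> bool" where
  "homogeneous_on D f \<longleftrightarrow> (\<forall>x\<in>D. \<forall>c>0. f (c *\<^sub>R x) = c *\<^sub>R f x)"

definition orbit_of :: "('a \<Rightarrow> 'a) \<Rightarrow> 'a \<Rightarrow> 'a set" where
  "orbit_of f x = {(f ^^ k) x |k. True}"

text \<open>Accumulation points of an orbit are subsequential limits of the sequence of iterates,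
  not limit points of the set \<open>orbit_of f x\<close>: the points of a periodic orbit count.\<close>

definition orbit_accumulation_point ::
    "('a::topological_space \<Rightarrow> 'a) \<Rightarrow> 'a \<Rightarrow> 'a \<Rightarrow> bool" where
  "orbit_accumulation_point f x y \<longleftrightarrow>
     (\<exists>k :: nat \<Rightarrow> nat. strict_mono k \<and> (\<lambda>i. (f ^^ k i) x) \<longlonglongrightarrow> y)"

end

theory Submission
  imports Defs
begin

text \<open>
  The orbit of \<open>x\<close> is bounded as soon as one subsequence of it is bounded, wherever that
  subsequence accumulates. The argument is an order-theoretic form of Calka's theorem on
  nonexpansive maps of proper metric spaces.

  Write \<open>\<le>\<close> for the cone order. As \<open>f\<close> is homogeneous and order-preserving, \<open>u \<le> c v\<close> implies
  \<open>f\<^sup>n u \<le> c f\<^sup>n v\<close>. A bounded subsequence gives a constant \<open>K\<close> with \<open>f\<^sup>k x \<le> K x\<close> for infinitely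
  many \<open>k\<close>. Let \<open>A\<close> be the set of all \<open>k\<close> with \<open>f\<^sup>k x \<le> 2 K x\<close>. The point is that \<open>A\<close> has bounded
  gaps. Otherwise there are \<open>k\<^sub>N \<in> A\<close> such that none of \<open>k\<^sub>N + 1, \<dots>, k\<^sub>N + N\<close> lies in \<open>A\<close>. Each of the
  finitely many functionals defining \<open>C\<close> is nonnegative and bounded on the points indexed by
  \<open>A\<close>, and every bounded sequence of nonnegative reals has a subsequence in which no later
  term exceeds twice an earlier one (\<open>simultaneous_almost_decreasing_subseq\<close>). So, on a
  subsequence, later points are \<open>\<le>\<close> twice earlier ones. Let \<open>q\<close> be the first index, and
  choose \<open>n \<ge> 1\<close> with \<open>f\<^bsup>q+n\<^esup> x \<le> K x\<close>. For every later index \<open>k\<close> one gets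
  \<open>f\<^bsup>k+n\<^esup> x \<le> 2 f\<^bsup>q+n\<^esup> x \<le> 2 K x\<close>, that is, a return to \<open>A\<close> after \<open>n\<close> steps, with \<open>n\<close> independent
  of \<open>k\<close>: a contradiction. Only this one-sided comparison is needed, and it is insensitive to
  functionals that tend to \<open>0\<close> along the orbit; this is why the boundary causes no difficulty.

  With gaps bounded by \<open>N\<close>, every late iterate is \<open>\<le> 2 K f\<^sup>s x\<close> for some \<open>s \<le> N\<close>, so the orbit lies
  in an order interval, and order intervals of a polyhedral cone are norm bounded, because a
  vector is a fixed linear expression in the values of the defining functionals
  (\<open>linear_coordinates_on_subspace\<close>).
\<close>

section \<open>Almost decreasing subsequences\<close>

lemma almost_decreasing_subseq:
  fixes g :: "nat \<Rightarrow> real"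
  assumes nonneg: "\<And>n. 0 \<le> g n" and bound: "\<And>n. g n \<le> b"
  shows "\<exists>r :: nat \<Rightarrow> nat. strict_mono r \<and> (\<forall>i j. i < j \<longrightarrow> g (r j) \<le> 2 * g (r i))"
proof -
  obtain r :: "nat \<Rightarrow> nat" where r: "strict_mono r" "monoseq (\<lambda>n. g (r n))"
    using seq_monosub by blast
  consider "incseq (\<lambda>n. g (r n))" | "decseq (\<lambda>n. g (r n))"
    using r(2) by (auto simp: monoseq_iff)
  then show ?thesis
  proof cases
    case 1
    obtain L where lim: "(\<lambda>n. g (r n)) \<longlonglongrightarrow> L" and le: "\<And>n. g (r n) \<le> L"
      using incseq_convergent[OF 1, of b] bound by blast
    have "\<exists>m. \<forall>n\<ge>m. L \<le> 2 * g (r n)"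
    proof (cases "L \<le> 0")
      case True
      have "L \<le> 2 * g (r n)" for n
        using True nonneg[of "r n"] by linarith
      then show ?thesis by blast
    next
      case False
      then have "\<forall>\<^sub>F n in sequentially. L / 2 < g (r n)"
        by (intro order_tendstoD(1)[OF lim]) auto
      then obtain m where "\<forall>n\<ge>m. L / 2 < g (r n)"
        by (auto simp: eventually_sequentially)
      then show ?thesis by (intro exI[of _ m]) force
    qed
    then obtain m where m: "\<And>n. n \<ge> m \<Longrightarrow> L \<le> 2 * g (r n)" by blast
    have "strict_mono (\<lambda>n. r (n + m))"
      using r(1) by (auto simp: strict_mono_def)
    moreover have "g (r (j + m)) \<le> 2 * g (r (i + m))" for i j
      using le[of "j + m"] m[of "i + m"] by simp
    ultimately show ?thesis by blast
  next
    case 2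
    have "g (r j) \<le> 2 * g (r i)" if "i < j" for i j
      using decseqD[OF 2, of i j] nonneg[of "r i"] that by simp
    with r(1) show ?thesis by blast
  qed
qed

lemma simultaneous_almost_decreasing_subseq:
  fixes g :: "'b \<Rightarrow> nat \<Rightarrow> real"
  assumes "finite \<Phi>" and "\<And>\<phi> n. \<phi> \<in> \<Phi> \<Longrightarrow> 0 \<le> g \<phi> n" and "\<And>\<phi> n. \<phi> \<in> \<Phi> \<Longrightarrow> g \<phi> n \<le> b \<phi>"
  shows "\<exists>r :: nat \<Rightarrow> nat. strict_mono r \<and>
           (\<forall>\<phi>\<in>\<Phi>. \<forall>i j. i < j \<longrightarrow> g \<phi> (r j) \<le> 2 * g \<phi> (r i))"
  using assms
proof (induction \<Phi> rule: finite_induct)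
  case empty
  show ?case by (auto intro: exI[of _ id] strict_mono_id)
next
  case (insert \<psi> \<Phi>)
  obtain r :: "nat \<Rightarrow> nat" where r: "strict_mono r"
    "\<forall>\<phi>\<in>\<Phi>. \<forall>i j. i < j \<longrightarrow> g \<phi> (r j) \<le> 2 * g \<phi> (r i)"
    using insert.IH insert.prems by (metis insertCI)
  obtain s :: "nat \<Rightarrow> nat" where s: "strict_mono s"
    "\<forall>i j. i < j \<longrightarrow> g \<psi> (r (s j)) \<le> 2 * g \<psi> (r (s i))"
    using almost_decreasing_subseq[of "\<lambda>n. g \<psi> (r n)" "b \<psi>"] insert.prems by auto
  have "strict_mono (r \<circ> s)" using r(1) s(1) by (rule strict_mono_o)
  moreover have "\<forall>\<phi>\<in>insert \<psi> \<Phi>. \<forall>i j. i < j \<longrightarrow> g \<phi> ((r \<circ> s) j) \<le> 2 * g \<phi> ((r \<circ> s) i)"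
    using r(2) s by (auto simp: strict_mono_less)
  ultimately show ?case by blast
qed

section \<open>Order and norm in polyhedral cones\<close>

text \<open>Finitely many functionals without a common nonzero zero on a subspace determine its
  vectors linearly. The induction on the set of functionals passes to the kernel of one of them,
  which is why a subspace is carried along.\<close>

lemma linear_coordinates_on_subspace:
  fixes \<Phi> :: "('a::real_vector \<Rightarrow> real) set"
  assumes "finite \<Phi>" and "\<And>\<phi>. \<phi> \<in> \<Phi> \<Longrightarrow> linear \<phi>" and "subspace S"
    and "\<And>z. z \<in> S \<Longrightarrow> (\<forall>\<phi>\<in>\<Phi>. \<phi> z = 0) \<Longrightarrow> z = 0"
  shows "\<exists>e :: ('a \<Rightarrow> real) \<Rightarrow> 'a. \<forall>z\<in>S. z = (\<Sum>\<phi>\<in>\<Phi>. \<phi> z *\<^sub>R e \<phi>)"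
  using assms
proof (induction \<Phi> arbitrary: S rule: finite_induct)
  case empty
  then show ?case by auto
next
  case (insert \<psi> \<Phi>)
  have lin\<psi>: "linear \<psi>" and lin: "\<And>\<phi>. \<phi> \<in> \<Phi> \<Longrightarrow> linear \<phi>"
    using insert.prems(1) by auto
  have "subspace (S \<inter> {z. \<psi> z = 0})"
    by (intro subspace_inter insert.prems(2) linear_subspace_kernel lin\<psi>)
  then obtain e where e: "\<And>z. z \<in> S \<Longrightarrow> \<psi> z = 0 \<Longrightarrow> z = (\<Sum>\<phi>\<in>\<Phi>. \<phi> z *\<^sub>R e \<phi>)"
    using insert.IH[of "S \<inter> {z. \<psi> z = 0}"] insert.prems by force
  show ?case
  proof (cases "\<forall>z\<in>S. \<psi> z = 0")
    case True
    have "z = (\<Sum>\<phi>\<in>insert \<psi> \<Phi>. \<phi> z *\<^sub>R e \<phi>)" if "z \<in> S" for z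
      using e[of z] True that insert.hyps by simp
    then show ?thesis by blast
  next
    case False
    then obtain w where w: "w \<in> S" "\<psi> w \<noteq> 0" by blast
    define v where "v = (1 / \<psi> w) *\<^sub>R w"
    have v: "v \<in> S" "\<psi> v = 1"
      using w insert.prems(2) by (auto simp: v_def subspace_scale linear_scale[OF lin\<psi>])
    define d where "d = e(\<psi> := v - (\<Sum>\<phi>\<in>\<Phi>. \<phi> v *\<^sub>R e \<phi>))"
    have "z = (\<Sum>\<phi>\<in>insert \<psi> \<Phi>. \<phi> z *\<^sub>R d \<phi>)" if z: "z \<in> S" for z
    proof -
      have "z - \<psi> z *\<^sub>R v = (\<Sum>\<phi>\<in>\<Phi>. \<phi> (z - \<psi> z *\<^sub>R v) *\<^sub>R e \<phi>)"
        using z v insert.prems(2)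
        by (intro e) (auto simp: subspace_diff subspace_scale linear_diff[OF lin\<psi>]
              linear_scale[OF lin\<psi>])
      also have "\<dots> = (\<Sum>\<phi>\<in>\<Phi>. \<phi> z *\<^sub>R e \<phi> - \<psi> z *\<^sub>R (\<phi> v *\<^sub>R e \<phi>))"
        by (intro sum.cong) (auto simp: linear_diff[OF lin] linear_scale[OF lin] algebra_simps)
      also have "\<dots> = (\<Sum>\<phi>\<in>\<Phi>. \<phi> z *\<^sub>R e \<phi>) - \<psi> z *\<^sub>R (\<Sum>\<phi>\<in>\<Phi>. \<phi> v *\<^sub>R e \<phi>)"
        by (simp only: sum_subtractf scaleR_sum_right)
      finally have "z = \<psi> z *\<^sub>R d \<psi> + (\<Sum>\<phi>\<in>\<Phi>. \<phi> z *\<^sub>R e \<phi>)"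
        by (simp add: d_def algebra_simps)
      also have "(\<Sum>\<phi>\<in>\<Phi>. \<phi> z *\<^sub>R e \<phi>) = (\<Sum>\<phi>\<in>\<Phi>. \<phi> z *\<^sub>R d \<phi>)"
        using insert.hyps by (intro sum.cong) (auto simp: d_def)
      finally show ?thesis using insert.hyps by simp
    qed
    then show ?thesis by blast
  qed
qed

lemma polyhedral_cone_order_interval_bounded:
  fixes C :: "'a::real_normed_vector set"
  assumes "polyhedral_cone C"
  shows "bounded {z \<in> C. cone_le C z u}"
proof -
  obtain \<Phi> :: "('a \<Rightarrow> real) set" where fin: "finite \<Phi>" and lin: "\<And>\<phi>. \<phi> \<in> \<Phi> \<Longrightarrow> linear \<phi>"
    and C: "C = (\<Inter>\<phi>\<in>\<Phi>. {x. \<phi> x \<ge> 0})" and pointed: "C \<inter> uminus ` C = {0}"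
    using assms unfolding polyhedral_cone_def pointed_cone_def by blast
  have kernel: "z = 0" if "z \<in> UNIV" "\<forall>\<phi>\<in>\<Phi>. \<phi> z = 0" for z
  proof -
    have "z \<in> C" "- z \<in> C"
      using that lin by (auto simp: C linear_neg)
    then have "z \<in> C \<inter> uminus ` C" by (auto intro: image_eqI[of _ _ "- z"])
    with pointed show ?thesis by simp
  qed
  obtain e :: "('a \<Rightarrow> real) \<Rightarrow> 'a" where e: "\<forall>z\<in>UNIV. z = (\<Sum>\<phi>\<in>\<Phi>. \<phi> z *\<^sub>R e \<phi>)"
    using linear_coordinates_on_subspace[OF fin lin subspace_UNIV kernel] by (rule exE)
  have "norm z \<le> (\<Sum>\<phi>\<in>\<Phi>. \<phi> u * norm (e \<phi>))" if "z \<in> C" "cone_le C z u" for z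
  proof -
    have \<phi>: "0 \<le> \<phi> z" "\<phi> z \<le> \<phi> u" if "\<phi> \<in> \<Phi>" for \<phi>
      using that \<open>z \<in> C\<close> \<open>cone_le C z u\<close> by (auto simp: C cone_le_def linear_diff[OF lin])
    have "norm z \<le> (\<Sum>\<phi>\<in>\<Phi>. norm (\<phi> z *\<^sub>R e \<phi>))"
      using norm_sum[of "\<lambda>\<phi>. \<phi> z *\<^sub>R e \<phi>" \<Phi>]
      unfolding bspec[OF e UNIV_I, of z, symmetric] .
    also have "\<dots> \<le> (\<Sum>\<phi>\<in>\<Phi>. \<phi> u * norm (e \<phi>))"
      using \<phi> by (intro sum_mono) (auto intro: mult_right_mono)
    finally show ?thesis .
  qed
  then show ?thesis by (auto simp: bounded_iff)
qed

lemma bounded_set_le_multiple_of_interior_point: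
  fixes C :: "'a::real_normed_vector set"
  assumes "cone C" and "x \<in> interior C" and "bounded S"
  obtains K :: real where "K > 0" and "\<And>z. z \<in> S \<Longrightarrow> cone_le C z (K *\<^sub>R x)"
proof -
  obtain \<epsilon> where \<epsilon>: "\<epsilon> > 0" "ball x \<epsilon> \<subseteq> C"
    using assms(2) by (auto simp: mem_interior)
  obtain B where B: "B > 0" "\<And>z. z \<in> S \<Longrightarrow> norm z \<le> B"
    using assms(3) by (auto simp: bounded_pos)
  define K where "K = 2 * B / \<epsilon>"
  have K: "K > 0" using \<epsilon>(1) B(1) by (simp add: K_def)
  have "cone_le C z (K *\<^sub>R x)" if "z \<in> S" for z
  proof -
    have "norm z / K \<le> B / K" using B(2)[OF that] K by (simp add: divide_right_mono)
    also have "\<dots> < \<epsilon>" using \<epsilon>(1) B(1) by (simp add: K_def)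
    finally have "x - (1 / K) *\<^sub>R z \<in> C"
      using K \<epsilon>(2) by (intro subsetD[OF \<epsilon>(2)]) (simp add: dist_norm)
    then have "K *\<^sub>R (x - (1 / K) *\<^sub>R z) \<in> C"
      using assms(1) K by (simp add: cone_def)
    then show ?thesis using K by (simp add: cone_le_def algebra_simps)
  qed
  with K show ?thesis by (rule that)
qed

lemma cone_le_trans:
  assumes "convex C" "cone C" "cone_le C u v" "cone_le C v w"
  shows "cone_le C u w"
proof -
  have "(v - u) + (w - v) \<in> C"
    using assms convex_cone[of C] unfolding cone_le_def by blast
  then show ?thesis by (simp add: cone_le_def)
qed

lemma cone_le_scale:
  assumes "cone C" "0 \<le> c" "cone_le C u v"
  shows "cone_le C (c *\<^sub>R u) (c *\<^sub>R v)"
  using assms by (simp add: cone_le_def cone_def flip: scaleR_diff_right)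

section \<open>Orbits with a bounded subsequence\<close>

lemma funpow_in_interior:
  assumes "f \<in> interior C \<rightarrow> interior C" "u \<in> interior C"
  shows "(f ^^ n) u \<in> interior C"
  using assms by (induction n) auto

lemma scale_in_interior:
  fixes C :: "'a::real_normed_vector set"
  assumes "cone C" "u \<in> interior C" "c > 0"
  shows "c *\<^sub>R u \<in> interior C"
proof -
  have "open ((*\<^sub>R) c ` interior C)"
    using assms(3) by (intro open_scaling) auto
  moreover have "(*\<^sub>R) c ` interior C \<subseteq> C"
    using assms(1,3) interior_subset[of C] by (auto simp: cone_def)
  ultimately have "(*\<^sub>R) c ` interior C \<subseteq> interior C" by (intro interior_maximal)
  then show ?thesis using assms(2) by blast
qed

text \<open>Iteration does not increase the infimum of the \<open>c > 0\<close> with \<open>u \<le> c v\<close>; this is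
  nonexpansiveness for the Funk metric of the cone, the logarithm of that infimum.\<close>

lemma funpow_preserves_scaled_order:
  fixes C :: "'a::real_normed_vector set"
  assumes "cone C" and "f \<in> interior C \<rightarrow> interior C"
    and "order_preserving_on C (interior C) f" and "homogeneous_on (interior C) f"
    and "u \<in> interior C" "v \<in> interior C" "c > 0" "cone_le C u (c *\<^sub>R v)"
  shows "cone_le C ((f ^^ n) u) (c *\<^sub>R (f ^^ n) v)"
proof (induction n)
  case 0
  show ?case using assms(8) by simp
next
  case (Suc n)
  have *: "(f ^^ n) u \<in> interior C" "(f ^^ n) v \<in> interior C"
    using assms(2,5,6) by (auto intro: funpow_in_interior)
  have "cone_le C (f ((f ^^ n) u)) (f (c *\<^sub>R (f ^^ n) v))"
    using Suc * assms(3) scale_in_interior[OF assms(1) *(2) assms(7)]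
    by (simp add: order_preserving_on_def)
  also have "f (c *\<^sub>R (f ^^ n) v) = c *\<^sub>R f ((f ^^ n) v)"
    using * assms(4,7) by (simp add: homogeneous_on_def)
  finally show ?case by simp
qed

lemma bounded_gaps_reach:
  fixes A :: "nat set"
  assumes gaps: "\<And>k. k \<in> A \<Longrightarrow> \<exists>n\<in>{1..N}. k + n \<in> A" and "m \<in> A" "m \<le> k"
  shows "\<exists>a\<in>A. \<exists>s\<le>N. k = a + s"
proof -
  have fin: "finite {a \<in> A. a \<le> k}" and ne: "{a \<in> A. a \<le> k} \<noteq> {}"
    using assms(2,3) by auto
  define a where "a = Max {a \<in> A. a \<le> k}"
  have a: "a \<in> A" "a \<le> k" using Max_in[OF fin ne] by (auto simp: a_def)
  obtain n where n: "n \<in> {1..N}" "a + n \<in> A" using gaps[OF a(1)] by blast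
  have "k < a + n"
  proof (rule ccontr)
    assume "\<not> k < a + n"
    then have "a + n \<le> a" using n(2) Max_ge[OF fin, of "a + n"] by (simp add: a_def)
    with n(1) show False by simp
  qed
  then show ?thesis using a n(1) by (intro bexI[of _ a] exI[of _ "k - a"]) auto
qed

lemma orbit_bounded_if_subsequence_bounded:
  fixes C :: "'a::real_normed_vector set" and f :: "'a \<Rightarrow> 'a"
  assumes polyhedral: "polyhedral_cone C"
    and maps: "f \<in> interior C \<rightarrow> interior C"
    and order_preserving: "order_preserving_on C (interior C) f"
    and homogeneous: "homogeneous_on (interior C) f"
    and x: "x \<in> interior C"
    and k: "strict_mono (k :: nat \<Rightarrow> nat)" "bounded (range (\<lambda>i. (f ^^ k i) x))"
  shows "bounded (orbit_of f x)"
proof -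
  let ?z = "\<lambda>n. (f ^^ n) x"
  obtain \<Phi> :: "('a \<Rightarrow> real) set" where fin: "finite \<Phi>" and lin: "\<And>\<phi>. \<phi> \<in> \<Phi> \<Longrightarrow> linear \<phi>"
    and C: "C = (\<Inter>\<phi>\<in>\<Phi>. {x. \<phi> x \<ge> 0})" and cone: "cone C" and convex: "convex C"
    using polyhedral unfolding polyhedral_cone_def pointed_cone_def by blast
  note trans = cone_le_trans[OF convex cone]
  note iterate = funpow_preserves_scaled_order[OF cone maps order_preserving homogeneous]
  have z: "?z n \<in> interior C" for n
    using maps x by (rule funpow_in_interior)
  then have zC: "?z n \<in> C" for n using interior_subset by blast
  have le_iff: "cone_le C u v \<longleftrightarrow> (\<forall>\<phi>\<in>\<Phi>. \<phi> u \<le> \<phi> v)" for u v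
    by (auto simp: C cone_le_def linear_diff[OF lin])
  obtain K where K: "K > 0" "\<And>i. cone_le C (?z (k i)) (K *\<^sub>R x)"
    using bounded_set_le_multiple_of_interior_point[OF cone x k(2)] by (metis rangeI)
  define A where "A = {n. cone_le C (?z n) ((2 * K) *\<^sub>R x)}"

  have "\<exists>N. \<forall>m\<in>A. \<exists>n\<in>{1..N}. m + n \<in> A"
  proof (rule ccontr)
    assume "\<not> ?thesis"
    then obtain m where m: "\<And>N. m N \<in> A" "\<And>N n. n \<in> {1..N} \<Longrightarrow> m N + n \<notin> A"
      by metis
    have "0 \<le> \<phi> (?z (m N))" "\<phi> (?z (m N)) \<le> \<phi> ((2 * K) *\<^sub>R x)" if "\<phi> \<in> \<Phi>" for \<phi> N
      using that zC[of "m N"] m(1)[of N] le_iff by (auto simp: C A_def)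
    then obtain r :: "nat \<Rightarrow> nat" where r: "strict_mono r"
      "\<And>\<phi> i j. \<phi> \<in> \<Phi> \<Longrightarrow> i < j \<Longrightarrow> \<phi> (?z (m (r j))) \<le> 2 * \<phi> (?z (m (r i)))"
      using simultaneous_almost_decreasing_subseq
        [OF fin, of "\<lambda>\<phi> N. \<phi> (?z (m N))" "\<lambda>\<phi>. \<phi> ((2 * K) *\<^sub>R x)"] by blast
    define q where "q = m (r 0)"
    define n where "n = k (Suc q) - q"
    have n: "1 \<le> n" "q + n = k (Suc q)"
      using strict_mono_imp_increasing[OF k(1), of "Suc q"] by (auto simp: n_def)
    \<comment> \<open>Any index that is positive and at least \<open>n\<close> would do in place of \<open>n\<close>: the gap after
      \<open>m (r n)\<close> is longer than \<open>r n \<ge> n\<close>.\<close>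
    define p where "p = m (r n)"
    have "cone_le C (?z p) (2 *\<^sub>R ?z q)"
      using r(2)[of _ 0 n] n(1) by (auto simp: le_iff p_def q_def linear_scale[OF lin])
    then have "cone_le C ((f ^^ n) (?z p)) (2 *\<^sub>R (f ^^ n) (?z q))"
      using z by (intro iterate) auto
    moreover have "(f ^^ n) (?z p) = ?z (p + n)" "(f ^^ n) (?z q) = ?z (k (Suc q))"
      by (simp_all add: add.commute flip: n(2) funpow_add[THEN fun_cong, unfolded o_apply])
    moreover have "cone_le C (2 *\<^sub>R ?z (k (Suc q))) ((2 * K) *\<^sub>R x)"
      using cone_le_scale[OF cone, of 2] K(2)[of "Suc q"] by fastforce
    ultimately have "p + n \<in> A" using trans by (auto simp: A_def)
    moreover have "n \<le> r n" using strict_mono_imp_increasing[OF r(1)] .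
    ultimately show False using m(2)[of n "r n"] n(1) by (simp add: p_def)
  qed
  then obtain N where N: "\<And>m. m \<in> A \<Longrightarrow> \<exists>n\<in>{1..N}. m + n \<in> A" by blast

  obtain L where L: "L > 0" "\<And>n. n \<in> {..N} \<Longrightarrow> cone_le C (?z n) (L *\<^sub>R x)"
    using bounded_set_le_multiple_of_interior_point[OF cone x, of "?z ` {..N}"]
    by (metis finite_imp_bounded finite_atMost finite_imageI imageI)
  have "K *\<^sub>R x \<in> C" using cone K(1) x interior_subset[of C] by (auto simp: cone_def)
  then have "cone_le C (K *\<^sub>R x) ((2 * K) *\<^sub>R x)"
    by (simp add: cone_le_def flip: scaleR_diff_left)
  then have start: "k 0 \<in> A" using trans[OF K(2)[of 0]] by (simp add: A_def)
  have "cone_le C (?z n) ((2 * K * L) *\<^sub>R x)" if late: "k 0 \<le> n" for n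
  proof -
    obtain a s where as: "a \<in> A" "s \<le> N" "n = a + s"
      using bounded_gaps_reach[OF N start late] by blast
    have "cone_le C ((f ^^ s) (?z a)) ((2 * K) *\<^sub>R ?z s)"
      using as(1) z x K(1) by (intro iterate) (auto simp: A_def)
    moreover have "(f ^^ s) (?z a) = ?z n"
      by (simp add: as(3) add.commute flip: funpow_add[THEN fun_cong, unfolded o_apply])
    moreover have "cone_le C ((2 * K) *\<^sub>R ?z s) ((2 * K) *\<^sub>R (L *\<^sub>R x))"
      using L(2)[of s] as(2) K(1) by (intro cone_le_scale[OF cone]) auto
    ultimately show ?thesis using trans by auto
  qed
  then have late: "?z n \<in> {z \<in> C. cone_le C z ((2 * K * L) *\<^sub>R x)}" if "k 0 \<le> n" for n
    using that zC by blast
  have "orbit_of f x \<subseteq> ?z ` {..<k 0} \<union> {z \<in> C. cone_le C z ((2 * K * L) *\<^sub>R x)}"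
  proof
    fix v assume "v \<in> orbit_of f x"
    then obtain n where n: "v = ?z n" by (auto simp: orbit_of_def)
    show "v \<in> ?z ` {..<k 0} \<union> {z \<in> C. cone_le C z ((2 * K * L) *\<^sub>R x)}"
      unfolding n using late[of n] not_less[of n "k 0"] by blast
  qed
  moreover have "bounded \<dots>"
    using polyhedral_cone_order_interval_bounded[OF polyhedral]
    by (simp add: finite_imp_bounded)
  ultimately show ?thesis by (metis bounded_subset)
qed

theorem theorem7p4:
  fixes C :: "'a::real_normed_vector set" and f :: "'a \<Rightarrow> 'a"
  assumes finite_dim: "\<exists>B :: 'a set. finite B \<and> span B = UNIV"
    and polyhedral: "polyhedral_cone C"
    and nonempty_interior: "interior C \<noteq> {}"
    and maps: "f \<in> interior C \<rightarrow> interior C"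
    and order_preserving: "order_preserving_on C (interior C) f"
    and homogeneous: "homogeneous_on (interior C) f"
  shows "\<not> (\<exists>x \<in> interior C. (\<exists>y \<in> frontier C. orbit_accumulation_point f x y)
           \<and> \<not> bounded (orbit_of f x))"
proof -
  have "bounded (orbit_of f x)" if "x \<in> interior C" "orbit_accumulation_point f x y" for x y
  proof -
    obtain k :: "nat \<Rightarrow> nat" where "strict_mono k" "(\<lambda>i. (f ^^ k i) x) \<longlonglongrightarrow> y"
      using \<open>orbit_accumulation_point f x y\<close> by (auto simp: orbit_accumulation_point_def)
    then show ?thesis
      using orbit_bounded_if_subsequence_bounded[OF polyhedral maps order_preserving homogeneous]
        that(1) convergent_imp_bounded by blast
  qed
  then show ?thesis by blast
qed

end
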